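(* Let $X$ be a coanalytic separable metrizable space, let $\mathcal{A}$ be a cofinal adequate family of closed subsets of $X$ and let $Z\subset X$. Then $\mathcal{A}|_Z$ is an Eberlein compact if and only if $Z$ is contained in some $\sigma$-compact subset of $X$.
   Context: A family $\mathcal{A}$ of subsets of a set $X$ is adequate if a subset $B\subset X$ belongs to $\mathcal{A}$ if and only if every finite subset of $B$ belongs to $\mathcal{A}$. An adequate family $\mathcal{A}$ of closed subsets of $X$ is cofinal if every infinite closed discrete subset $B$ of $X$ contains an infinite subset belonging to $\mathcal{A}$. For $Z\subset X$, $\mathcal{A}|_Z=\{A\cap Z : A\in\mathcal{A}\}=\{A\in\mathcal{A}: A\subset Z\}$, which is an adequate family on $Z$, viewed as a compact subset of $\{0,1\}^Z$. A compact space $K$ is Eberlein compact if the Banach space $C(K)$ is weakly compactly generated. *)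

theory Defs
  imports "HOL-Analysis.Analysis"
begin

definition Polish_space :: "'b topology \<Rightarrow> bool" where
  "Polish_space P \<longleftrightarrow> completely_metrizable_space P \<and> separable_space P"

definition baire_space :: "(nat \<Rightarrow> nat) topology" where
  "baire_space = product_topology (\<lambda>_. discrete_topology (UNIV::nat set)) (UNIV::nat set)"

definition analytic_in :: "'b topology \<Rightarrow> 'b set \<Rightarrow> bool" where
  "analytic_in P S \<longleftrightarrow> S \<subseteq> topspace P \<and>
     (S = {} \<or> (\<exists>f. continuous_map baire_space P f \<and> f ` topspace baire_space = S))"

definition coanalytic_in :: "'b topology \<Rightarrow> 'b set \<Rightarrow> bool" where
  "coanalytic_in P S \<longleftrightarrow> S \<subseteq> topspace P \<and> analytic_in P (topspace P - S)"

definition adequate :: "'a topology \<Rightarrow> 'a set set \<Rightarrow> bool" where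
  "adequate X \<A> \<longleftrightarrow> \<A> \<subseteq> Pow (topspace X) \<and>
     (\<forall>B \<subseteq> topspace X. B \<in> \<A> \<longleftrightarrow> (\<forall>F. finite F \<and> F \<subseteq> B \<longrightarrow> F \<in> \<A>))"

definition closed_discrete_in :: "'a topology \<Rightarrow> 'a set \<Rightarrow> bool" where
  "closed_discrete_in X B \<longleftrightarrow> closedin X B \<and> subtopology X B = discrete_topology B"

definition cofinal_adequate :: "'a topology \<Rightarrow> 'a set set \<Rightarrow> bool" where
  "cofinal_adequate X \<A> \<longleftrightarrow> adequate X \<A> \<and> (\<forall>A\<in>\<A>. closedin X A) \<and>
     (\<forall>B. closed_discrete_in X B \<and> infinite B \<longrightarrow> (\<exists>C. C \<subseteq> B \<and> infinite C \<and> C \<in> \<A>))"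

definition restrict_family :: "'a set set \<Rightarrow> 'a set \<Rightarrow> 'a set set" where
  "restrict_family \<A> Z = {A \<inter> Z | A. A \<in> \<A>}"

definition cantor_cube :: "'a set \<Rightarrow> ('a \<Rightarrow> bool) topology" where
  "cantor_cube Z = product_topology (\<lambda>_. discrete_topology (UNIV::bool set)) Z"

definition family_space :: "'a set \<Rightarrow> 'a set set \<Rightarrow> ('a \<Rightarrow> bool) topology" where
  "family_space Z \<B> = subtopology (cantor_cube Z) ((\<lambda>S. restrict (\<lambda>z. z \<in> S) Z) ` \<B>)"

definition Cfun :: "'b topology \<Rightarrow> ('b \<Rightarrow> real) set" where
  "Cfun K = {f. continuous_map K euclideanreal f \<and> (\<forall>x. x \<notin> topspace K \<longrightarrow> f x = 0)}"

definition supnorm :: "'b topology \<Rightarrow> ('b \<Rightarrow> real) \<Rightarrow> real" where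
  "supnorm K f = (if topspace K = {} then 0 else (SUP x\<in>topspace K. \<bar>f x\<bar>))"

definition Cdual :: "'b topology \<Rightarrow> (('b \<Rightarrow> real) \<Rightarrow> real) set" where
  "Cdual K = {\<phi>. (\<forall>f\<in>Cfun K. \<forall>g\<in>Cfun K. \<forall>a b::real.
                    \<phi> (\<lambda>x. a * f x + b * g x) = a * \<phi> f + b * \<phi> g) \<and>
                 (\<exists>M. \<forall>f\<in>Cfun K. \<bar>\<phi> f\<bar> \<le> M * supnorm K f)}"

definition weak_topology_C :: "'b topology \<Rightarrow> ('b \<Rightarrow> real) topology" where
  "weak_topology_C K = topology_generated_by
     {{f\<in>Cfun K. \<phi> f \<in> U} | \<phi> U. \<phi> \<in> Cdual K \<and> open U}"

definition lin_span_C :: "('b \<Rightarrow> real) set \<Rightarrow> ('b \<Rightarrow> real) set" where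
  "lin_span_C W = {g. \<exists>F c. finite F \<and> F \<subseteq> W \<and> g = (\<lambda>x. \<Sum>w\<in>F. c w * w x)}"

definition WCG_C :: "'b topology \<Rightarrow> bool" where
  "WCG_C K \<longleftrightarrow> (\<exists>W. W \<subseteq> Cfun K \<and> compactin (weak_topology_C K) W \<and>
     (\<forall>f\<in>Cfun K. \<forall>\<epsilon>>0. \<exists>g\<in>lin_span_C W. supnorm K (\<lambda>x. f x - g x) < \<epsilon>))"

definition Eberlein_compact :: "'b topology \<Rightarrow> bool" where
  "Eberlein_compact K \<longleftrightarrow> compact_space K \<and> Hausdorff_space K \<and> WCG_C K"

end

theory Submission
  imports Defs
begin

text \<open>If \<open>C(\<A>|\<^sub>Z)\<close> is weakly compactly generated by \<open>W\<close>, then \<open>Z\<close> is the union of countably many sets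
  \<open>Y\<close> on each of which the coordinate functions lie within \<open>1/4\<close> of one pointwise compact set of
  continuous functions, namely combinations of boundedly many elements of \<open>W\<close> with bounded
  coefficients. An infinite member of \<open>\<A>\<close> inside such a \<open>Y\<close> is impossible, since the cluster points
  of infinitely many distinct coordinates are far from continuous. By cofinality \<open>Y\<close> contains no
  infinite closed discrete set, so its closure in \<open>X\<close> is compact.

  Conversely, every member of \<open>\<A>\<close> is closed and discrete, as are its subsets, so it meets each
  compact set in a finite set. For \<open>Z\<close> covered by compact sets \<open>C n\<close>, the indicators of the sets
  \<open>{A. F \<subseteq> A}\<close>, \<open>F\<close> finite, can therefore be scaled so that they form, with \<open>0\<close>, a bounded and
  pointwise (hence weakly) compact set, whose span is dense.\<close>

subsection \<open>Bounded functionals on spaces of continuous functions\<close>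

lemma CfunD:
  assumes "f \<in> Cfun K"
  shows "continuous_map K euclideanreal f" "x \<notin> topspace K \<Longrightarrow> f x = 0"
  using assms by (simp_all add: Cfun_def)

lemma Cfun_zero: "(\<lambda>x. 0) \<in> Cfun K"
  by (simp add: Cfun_def)

lemma Cfun_lincomb:
  assumes "f \<in> Cfun K" "g \<in> Cfun K"
  shows "(\<lambda>x. a * f x + b * g x) \<in> Cfun K"
  using assms by (auto simp: Cfun_def intro!: continuous_intros)

lemma Cfun_diff:
  assumes "f \<in> Cfun K" "g \<in> Cfun K"
  shows "(\<lambda>x. f x - g x) \<in> Cfun K"
  using Cfun_lincomb[OF assms, of 1 "-1"] by simp

lemma Cfun_scale:
  assumes "f \<in> Cfun K"
  shows "(\<lambda>x. a * f x) \<in> Cfun K"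
  using Cfun_lincomb[OF assms assms, of a 0] by simp

lemma continuous_map_indicator_clopen:
  assumes "openin K U" "closedin K U"
  shows "continuous_map K euclideanreal (indicator U)"
proof -
  have "openin K {x \<in> topspace K. indicator U x \<in> V}" for V :: "real set"
  proof -
    have "{x \<in> topspace K. indicator U x \<in> V} =
        (if (1::real) \<in> V then U else {}) \<union> (if (0::real) \<in> V then topspace K - U else {})"
      using openin_subset[OF assms(1)] by (auto simp: indicator_def split: if_splits)
    then show ?thesis
      using assms by auto
  qed
  then show ?thesis
    by (simp add: continuous_map_def)
qed

lemma Cfun_mult_indicator:
  assumes "openin K U" "closedin K U" "f \<in> Cfun K"
  shows "(\<lambda>x. f x * indicator U x) \<in> Cfun K"
  using assms continuous_map_indicator_clopen[OF assms(1,2)]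
  by (auto simp: Cfun_def intro!: continuous_intros)

lemma Cfun_indicator:
  assumes "openin K U" "closedin K U"
  shows "indicator U \<in> Cfun K"
  using continuous_map_indicator_clopen[OF assms] openin_subset[OF assms(1)]
  by (auto simp: Cfun_def indicator_def)

lemma supnorm_upper:
  assumes "compact_space K" "f \<in> Cfun K" "x \<in> topspace K"
  shows "\<bar>f x\<bar> \<le> supnorm K f"
proof -
  have "compact (f ` topspace K)"
    using image_compactin[of K "topspace K" euclideanreal f] assms
    by (simp add: compact_space_def Cfun_def)
  then have "bounded (f ` topspace K)"
    by (rule compact_imp_bounded)
  then have "bdd_above ((\<lambda>x. \<bar>f x\<bar>) ` topspace K)"
    by (auto simp: bounded_iff bdd_above_def)
  then have "\<bar>f x\<bar> \<le> (SUP x\<in>topspace K. \<bar>f x\<bar>)"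
    using assms(3) by (intro cSUP_upper)
  then show ?thesis
    using assms(3) by (auto simp: supnorm_def)
qed

lemma supnorm_least:
  assumes "\<And>x. x \<in> topspace K \<Longrightarrow> \<bar>f x\<bar> \<le> c" "0 \<le> c"
  shows "supnorm K f \<le> c"
  using assms by (auto simp: supnorm_def intro!: cSUP_least)

lemma Cdual_lincomb:
  assumes "\<phi> \<in> Cdual K" "f \<in> Cfun K" "g \<in> Cfun K"
  shows "\<phi> (\<lambda>x. a * f x + b * g x) = a * \<phi> f + b * \<phi> g"
  using assms by (simp add: Cdual_def)

lemma Cdual_add:
  assumes "\<phi> \<in> Cdual K" "f \<in> Cfun K" "g \<in> Cfun K"
  shows "\<phi> (\<lambda>x. f x + g x) = \<phi> f + \<phi> g"
  using Cdual_lincomb[OF assms, of 1 1] by simp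

lemma Cdual_scale:
  assumes "\<phi> \<in> Cdual K" "f \<in> Cfun K"
  shows "\<phi> (\<lambda>x. a * f x) = a * \<phi> f"
  using Cdual_lincomb[OF assms assms(2), of a 0] by simp

text \<open>Boundedness in the form used below: a bound on the pointwise unit ball, with a strictly
  positive constant, so that it is safe to divide by it.\<close>

lemma Cdual_bound:
  assumes "\<phi> \<in> Cdual K"
  obtains M where "0 < M" "\<And>f. f \<in> Cfun K \<Longrightarrow> (\<And>x. \<bar>f x\<bar> \<le> 1) \<Longrightarrow> \<bar>\<phi> f\<bar> \<le> M"
proof -
  obtain M where M: "\<And>f. f \<in> Cfun K \<Longrightarrow> \<bar>\<phi> f\<bar> \<le> M * supnorm K f"
    using assms unfolding Cdual_def by blast
  have "\<bar>\<phi> f\<bar> \<le> \<bar>M\<bar> + 1" if f: "f \<in> Cfun K" "\<And>x. \<bar>f x\<bar> \<le> 1" for f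
  proof -
    have "supnorm K f \<le> 1" using f by (intro supnorm_least) auto
    \<comment> \<open>The pointwise bound on \<open>f\<close> keeps the supremum bounded above, so
      it dominates a value \<open>|f x|\<close>.\<close>
    moreover have "0 \<le> supnorm K f"
    proof (cases "topspace K = {}")
      case False
      then obtain x where x: "x \<in> topspace K" by blast
      have "bdd_above ((\<lambda>x. \<bar>f x\<bar>) ` topspace K)"
        using f(2) by (auto simp: bdd_above_def)
      then show ?thesis
        using x by (auto simp: supnorm_def intro!: cSUP_upper2)
    qed (simp add: supnorm_def)
    ultimately have "\<bar>M\<bar> * supnorm K f \<le> \<bar>M\<bar> * 1"
      by (intro mult_left_mono) auto
    moreover have "M * supnorm K f \<le> \<bar>M\<bar> * supnorm K f"
      using \<open>0 \<le> supnorm K f\<close> by (intro mult_right_mono) auto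
    ultimately show ?thesis using M[OF f(1)] by linarith
  qed
  then show ?thesis by (intro that[of "\<bar>M\<bar> + 1"]) auto
qed

text \<open>For clopen \<open>U\<close> and \<open>\<phi>\<close> represented by a signed measure \<open>\<mu>\<close>, this is \<open>|\<mu>| U\<close>; it stands in
  for the Riesz representation theorem.\<close>

definition functional_variation :: "'b topology \<Rightarrow> (('b \<Rightarrow> real) \<Rightarrow> real) \<Rightarrow> 'b set \<Rightarrow> real" where
  "functional_variation K \<phi> U =
     (SUP f\<in>{f \<in> Cfun K. (\<forall>x. \<bar>f x\<bar> \<le> 1) \<and> (\<forall>x. x \<notin> U \<longrightarrow> f x = 0)}. \<phi> f)"

section \<open>Variation of a bounded functional\<close>

context
  fixes K :: "'b topology" and \<phi> :: "('b \<Rightarrow> real) \<Rightarrow> real"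
  assumes \<phi>: "\<phi> \<in> Cdual K"
begin

abbreviation "var \<equiv> functional_variation K \<phi>"

lemma functional_variation_bdd:
  "bdd_above (\<phi> ` {f \<in> Cfun K. (\<forall>x. \<bar>f x\<bar> \<le> 1) \<and> (\<forall>x. x \<notin> U \<longrightarrow> f x = 0)})"
proof -
  obtain M where "0 < M" "\<And>f. f \<in> Cfun K \<Longrightarrow> (\<And>x. \<bar>f x\<bar> \<le> 1) \<Longrightarrow> \<bar>\<phi> f\<bar> \<le> M"
    using Cdual_bound[OF \<phi>] by blast
  then show ?thesis by (intro bdd_aboveI2[of _ _ M]) force
qed

lemma functional_variation_upper:
  assumes "f \<in> Cfun K" "\<And>x. \<bar>f x\<bar> \<le> 1" "\<And>x. x \<notin> U \<Longrightarrow> f x = 0"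
  shows "\<phi> f \<le> var U"
  unfolding functional_variation_def
  using assms by (intro cSUP_upper functional_variation_bdd) auto

lemma functional_variation_least:
  assumes "\<And>f. f \<in> Cfun K \<Longrightarrow> (\<And>x. \<bar>f x\<bar> \<le> 1) \<Longrightarrow> (\<And>x. x \<notin> U \<Longrightarrow> f x = 0) \<Longrightarrow> \<phi> f \<le> c"
  shows "var U \<le> c"
  unfolding functional_variation_def
proof (rule cSUP_least)
  show "{f \<in> Cfun K. (\<forall>x. \<bar>f x\<bar> \<le> 1) \<and> (\<forall>x. x \<notin> U \<longrightarrow> f x = 0)} \<noteq> {}"
    using Cfun_zero[of K] by auto
qed (use assms in auto)

lemma functional_variation_mono: "U \<subseteq> V \<Longrightarrow> var U \<le> var V"
  by (intro functional_variation_least functional_variation_upper) auto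

lemma functional_variation_empty: "var {} = 0"
proof -
  have 0: "\<phi> (\<lambda>x. 0) = 0"
    using Cdual_scale[OF \<phi> Cfun_zero, of 0] by simp
  show ?thesis
  proof (rule antisym)
    show "var {} \<le> 0"
    proof (rule functional_variation_least)
      fix f :: "'b \<Rightarrow> real" assume "\<And>x. x \<notin> {} \<Longrightarrow> f x = 0"
      then have "f = (\<lambda>x. 0)" by auto
      then show "\<phi> f \<le> 0" using 0 by simp
    qed
    show "0 \<le> var {}"
      using functional_variation_upper[OF Cfun_zero, of "{}"] 0 by simp
  qed
qed

text \<open>Both the indicator and its negative compete in the supremum defining the
  variation.\<close>

lemma abs_indicator_le_functional_variation:
  assumes "openin K U" "closedin K U"
  shows "\<bar>\<phi> (indicator U)\<bar> \<le> var U"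
proof -
  have "\<phi> (indicator U) \<le> var U"
    using assms by (intro functional_variation_upper Cfun_indicator) (auto simp: indicator_def)
  moreover have "\<phi> (\<lambda>x. -1 * indicator U x) \<le> var U"
    using assms
    by (intro functional_variation_upper Cfun_scale Cfun_indicator) (auto simp: indicator_def)
  ultimately show ?thesis
    using Cdual_scale[OF \<phi> Cfun_indicator[OF assms], of "-1"] by simp
qed

text \<open>Competitors for disjoint sets have disjoint supports, so their sum is still bounded by 1
  and competes for the union.\<close>

lemma functional_variation_superadditive:
  assumes "U \<inter> V = {}"
  shows "var U + var V \<le> var (U \<union> V)"
proof -
  have "var U \<le> var (U \<union> V) - var V"
  proof (rule functional_variation_least)
    fix f assume f: "f \<in> Cfun K" "\<And>x. \<bar>f x\<bar> \<le> 1" "\<And>x. x \<notin> U \<Longrightarrow> f x = 0"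
    have "var V \<le> var (U \<union> V) - \<phi> f"
    proof (rule functional_variation_least)
      fix g assume g: "g \<in> Cfun K" "\<And>x. \<bar>g x\<bar> \<le> 1" "\<And>x. x \<notin> V \<Longrightarrow> g x = 0"
      have "\<phi> (\<lambda>x. f x + g x) \<le> var (U \<union> V)"
      proof (rule functional_variation_upper)
        show "(\<lambda>x. f x + g x) \<in> Cfun K" using Cfun_lincomb[OF f(1) g(1), of 1 1] by simp
        show "\<bar>f x + g x\<bar> \<le> 1" for x
        proof (cases "x \<in> U")
          case True
          then have "x \<notin> V" using assms by auto
          then show ?thesis using f(2) g(3) by simp
        qed (use f(3) g(2) in simp)
      qed (use f(3) g(3) in auto)
      then show "\<phi> g \<le> var (U \<union> V) - \<phi> f"
        using Cdual_add[OF \<phi> f(1) g(1)] by simp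
    qed
    then show "\<phi> f \<le> var (U \<union> V) - var V" by simp
  qed
  then show ?thesis by simp
qed

text \<open>As \<open>V\<close> is clopen, cutting a competitor for \<open>U\<close> along
  \<open>V\<close> gives two continuous functions. The set \<open>U\<close> itself may be
  arbitrary.\<close>

lemma functional_variation_split:
  assumes "openin K V" "closedin K V"
  shows "var U \<le> var (U \<inter> V) + var (U - V)"
proof (rule functional_variation_least)
  fix f assume f: "f \<in> Cfun K" "\<And>x. \<bar>f x\<bar> \<le> 1" "\<And>x. x \<notin> U \<Longrightarrow> f x = 0"
  let ?g = "\<lambda>x. f x * indicator V x" and ?h = "\<lambda>x. f x - f x * indicator V x"
  have g: "?g \<in> Cfun K" and h: "?h \<in> Cfun K"
    using assms f(1) by (auto intro!: Cfun_diff Cfun_mult_indicator)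
  have "\<phi> ?g \<le> var (U \<inter> V)"
    using f by (intro functional_variation_upper g) (auto simp: indicator_def)
  moreover have "\<phi> ?h \<le> var (U - V)"
    using f by (intro functional_variation_upper h) (auto simp: indicator_def)
  moreover have "\<phi> f = \<phi> ?g + \<phi> ?h"
    using Cdual_add[OF \<phi> g h] by simp
  ultimately show "\<phi> f \<le> var (U \<inter> V) + var (U - V)" by linarith
qed

text \<open>Finite unions \<open>W n\<close> of the \<open>U i\<close>, \<open>i \<ge> n\<close>, that nearly exhaust the variation of all
  such unions have the finite intersection property, and a common point of the \<open>W n\<close> lies in
  infinitely many \<open>U i\<close>.\<close>

lemma clopen_limsup_nonempty:
  fixes U :: "nat \<Rightarrow> 'b set"
  assumes K: "compact_space K" and "0 < \<epsilon>"
    and clopen: "\<And>i. openin K (U i)" "\<And>i. closedin K (U i)"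
    and large: "\<And>i. \<epsilon> \<le> \<bar>\<phi> (indicator (U i))\<bar>"
  obtains x where "x \<in> topspace K" "infinite {i. x \<in> U i}"
proof -
  define \<delta> where "\<delta> n = \<epsilon> * (1/2) ^ Suc n" for n
  define V where "V n m = (\<Union>i\<in>{n..m}. U i)" for n m
  have \<delta>_pos: "0 < \<delta> n" for n using \<open>0 < \<epsilon>\<close> by (simp add: \<delta>_def)
  have \<delta>_sum: "(\<Sum>j<n. \<delta> j) < \<epsilon>" for n
  proof -
    have "(\<Sum>j<n. \<delta> j) = \<epsilon> * (1 - (1/2) ^ n)"
      by (induction n) (auto simp: \<delta>_def algebra_simps)
    moreover have "0 < \<epsilon> * (1/2) ^ n" using \<open>0 < \<epsilon>\<close> by simp
    ultimately show ?thesis by (simp add: algebra_simps)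
  qed
  have bdd: "bdd_above (range (\<lambda>m. var (V n m)))" for n
    by (rule bdd_aboveI2[of _ _ "var UNIV"]) (simp add: functional_variation_mono)
  \<comment> \<open>Some finite union comes within \<open>\<delta> n\<close> of the supremum over
    all \<open>m\<close>. Enlarging it to \<open>max n m\<close> ensures that \<open>U n\<close> is
    one of the sets united.\<close>
  have "\<exists>m\<ge>n. \<forall>m'. var (V n m') \<le> var (V n m) + \<delta> n" for n
  proof -
    have "(SUP m. var (V n m)) - \<delta> n < (SUP m. var (V n m))" using \<delta>_pos[of n] by simp
    then obtain m where m: "(SUP m. var (V n m)) - \<delta> n < var (V n m)"
      using less_cSUP_iff[OF _ bdd] by blast
    have "var (V n m) \<le> var (V n (max n m))"
      by (rule functional_variation_mono) (auto simp: V_def)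
    moreover have "var (V n m') \<le> (SUP m. var (V n m))" for m'
      by (rule cSUP_upper[OF _ bdd]) auto
    ultimately show ?thesis using m by (intro exI[of _ "max n m"]) (force intro: order_trans)
  qed
  then obtain m where m: "\<And>n. n \<le> m n" "\<And>n m'. var (V n m') \<le> var (V n (m n)) + \<delta> n"
    by metis
  define W where "W n = V n (m n)" for n
  have W_clopen: "openin K (W n)" "closedin K (W n)" for n
    using clopen by (auto simp: W_def V_def intro!: closedin_Union)
  have W_large: "\<epsilon> \<le> var (W n)" for n
  proof -
    have "\<epsilon> \<le> var (U n)"
      using large abs_indicator_le_functional_variation[OF clopen] order_trans by blast
    also have "\<dots> \<le> var (W n)"
      using m(1)[of n] by (intro functional_variation_mono) (auto simp: W_def V_def)
    finally show ?thesis .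
  qed
  \<comment> \<open>\<open>W n\<close> and \<open>W k\<close> both lie in one union starting at
    \<open>k\<close>, and \<open>W k\<close> already carries all but \<open>\<delta> k\<close> of
    its variation. By superadditivity little is left outside \<open>W k\<close>.\<close>
  have W_diff: "var (W n - W k) \<le> \<delta> k" if "k \<le> n" for n k
  proof -
    have "var (W n - W k) + var (W k) \<le> var (W n - W k \<union> W k)"
      by (rule functional_variation_superadditive) auto
    also have "\<dots> \<le> var (V k (max (m n) (m k)))"
    proof (rule functional_variation_mono)
      show "W n - W k \<union> W k \<subseteq> V k (max (m n) (m k))"
        using that unfolding W_def V_def by (auto 0 4 intro: order_trans le_max_iff_disj[THEN iffD2])
    qed
    also have "\<dots> \<le> var (W k) + \<delta> k" using m(2) by (simp add: W_def)
    finally show ?thesis by simp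
  qed
  \<comment> \<open>Intersecting with \<open>W j\<close> costs at most \<open>\<delta> j\<close>.
    The total cost stays below \<open>\<epsilon>\<close>, so the intersections keep positive
    variation and are nonempty.\<close>
  have W_Int: "\<epsilon> - (\<Sum>j<k. \<delta> j) \<le> var (W n \<inter> (\<Inter>j<k. W j))" if "k \<le> n" for n k
    using that
  proof (induction k)
    case 0
    then show ?case using W_large by simp
  next
    case (Suc k)
    let ?S = "W n \<inter> (\<Inter>j<k. W j)"
    have "var ?S \<le> var (?S \<inter> W k) + var (?S - W k)"
      by (rule functional_variation_split[OF W_clopen])
    moreover have "var (?S - W k) \<le> var (W n - W k)"
      by (rule functional_variation_mono) auto
    moreover have "?S \<inter> W k = W n \<inter> (\<Inter>j<Suc k. W j)"
      by (auto simp: less_Suc_eq)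
    ultimately show ?case using Suc W_diff[of k n] by simp
  qed
  define C where "C n = (\<Inter>j\<le>n. W j)" for n
  have "(\<Inter>n. C n) \<noteq> {}"
  proof (rule compact_space_imp_nest[OF K])
    show "closedin K (C n)" for n
      unfolding C_def using W_clopen by (intro closedin_Inter) auto
    show "C n \<noteq> {}" for n
    proof
      assume "C n = {}"
      moreover have "W n \<inter> (\<Inter>j<n. W j) = C n"
        by (force simp: C_def le_less)
      ultimately show False
        using W_Int[of n n] \<delta>_sum[of n] functional_variation_empty by simp
    qed
    show "decseq C" by (force simp: C_def decseq_def)
  qed
  then obtain x where x: "\<And>n. x \<in> W n" by (auto simp: C_def)
  show ?thesis
  proof
    show "x \<in> topspace K" using x[of 0] openin_subset[OF W_clopen(1)] by auto
    show "infinite {i. x \<in> U i}"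
      unfolding infinite_nat_iff_unbounded_le using x by (force simp: W_def V_def)
  qed
qed

end

text \<open>Every weak neighbourhood of 0 contains all but finitely many of the functions. Otherwise
  some functional is at least \<open>\<epsilon>\<close> in absolute value on infinitely many of
  them, and \<open>clopen_limsup_nonempty\<close> yields a point in infinitely many of the sets
  \<open>U i\<close>. Boundedness of the functional keeps the corresponding weights away from 0,
  contradicting \<open>fin\<close>.\<close>

lemma weakly_compact_weighted_indicators:
  fixes U :: "'i \<Rightarrow> 'b set" and w :: "'i \<Rightarrow> real"
  assumes K: "compact_space K"
    and clopen: "\<And>i. i \<in> I \<Longrightarrow> openin K (U i)" "\<And>i. i \<in> I \<Longrightarrow> closedin K (U i)"
    and w: "\<And>i. i \<in> I \<Longrightarrow> 0 < w i" "\<And>i. i \<in> I \<Longrightarrow> w i \<le> 1"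
    and fin: "\<And>x \<epsilon>. x \<in> topspace K \<Longrightarrow> 0 < \<epsilon> \<Longrightarrow> finite {i \<in> I. x \<in> U i \<and> \<epsilon> \<le> w i}"
  shows "compactin (weak_topology_C K)
           (insert (\<lambda>x. 0) ((\<lambda>i x. w i * indicator (U i) x) ` I))" (is "compactin _ (insert _ (?u ` I))")
proof -
  let ?B = "{{f \<in> Cfun K. \<phi> f \<in> V} | \<phi> V. \<phi> \<in> Cdual K \<and> open V}"
  have u: "?u i \<in> Cfun K" if "i \<in> I" for i
    using that clopen by (intro Cfun_scale Cfun_indicator) auto
  have \<phi>_fin: "finite {i \<in> I. \<epsilon> \<le> \<bar>\<phi> (?u i)\<bar>}" if \<phi>: "\<phi> \<in> Cdual K" and \<epsilon>: "0 < \<epsilon>" for \<phi> \<epsilon>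
  proof (rule ccontr)
    assume "infinite {i \<in> I. \<epsilon> \<le> \<bar>\<phi> (?u i)\<bar>}"
    then obtain s :: "nat \<Rightarrow> 'i" where s: "inj s" "range s \<subseteq> {i \<in> I. \<epsilon> \<le> \<bar>\<phi> (?u i)\<bar>}"
      using infinite_countable_subset by blast
    then have sI: "s n \<in> I" for n by auto
    obtain M where M: "0 < M" "\<And>f. f \<in> Cfun K \<Longrightarrow> (\<And>x. \<bar>f x\<bar> \<le> 1) \<Longrightarrow> \<bar>\<phi> f\<bar> \<le> M"
      using Cdual_bound[OF \<phi>] by blast
    have *: "\<epsilon> \<le> w (s n) * \<bar>\<phi> (indicator (U (s n)))\<bar>" for n
    proof -
      have "\<epsilon> \<le> \<bar>\<phi> (?u (s n))\<bar>" using s(2) by auto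
      also have "\<phi> (?u (s n)) = w (s n) * \<phi> (indicator (U (s n)))"
        by (rule Cdual_scale[OF \<phi> Cfun_indicator]) (use sI clopen in auto)
      finally show ?thesis using w(1)[OF sI] by (simp add: abs_mult less_imp_le)
    qed
    have "\<epsilon> \<le> \<bar>\<phi> (indicator (U (s n)))\<bar>" for n
    proof -
      have "w (s n) * \<bar>\<phi> (indicator (U (s n)))\<bar> \<le> 1 * \<bar>\<phi> (indicator (U (s n)))\<bar>"
        by (intro mult_right_mono w sI) simp
      then show ?thesis using *[of n] by simp
    qed
    then obtain x where x: "x \<in> topspace K" "infinite {n. x \<in> U (s n)}"
      using clopen_limsup_nonempty[OF \<phi> K \<epsilon>, of "\<lambda>n. U (s n)"] clopen sI by metis
    have "\<epsilon> / M \<le> w (s n)" for n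
    proof -
      have "\<bar>\<phi> (indicator (U (s n)))\<bar> \<le> M"
        by (intro M Cfun_indicator clopen sI) (simp add: indicator_def)
      then have "w (s n) * \<bar>\<phi> (indicator (U (s n)))\<bar> \<le> w (s n) * M"
        using w(1)[OF sI] by (intro mult_left_mono) (auto simp: less_imp_le)
      then show ?thesis using *[of n] M(1) by (simp add: divide_simps)
    qed
    then have "s ` {n. x \<in> U (s n)} \<subseteq> {i \<in> I. x \<in> U i \<and> \<epsilon> / M \<le> w i}" using sI by auto
    moreover have "finite {i \<in> I. x \<in> U i \<and> \<epsilon> / M \<le> w i}"
      using fin x(1) \<epsilon> M(1) by simp
    ultimately have "finite (s ` {n. x \<in> U (s n)})" by (rule finite_subset)
    then show False using x(2) finite_imageD inj_on_subset[OF s(1)] by blast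
  qed
  \<comment> \<open>Induction over the generation of the topology: an intersection unites two finite
    sets of exceptions, and for a union a single member containing 0 suffices.\<close>
  have cofinite: "finite {i \<in> I. ?u i \<notin> N}" if "generate_topology_on ?B N" "(\<lambda>x. 0) \<in> N" for N
    using that
  proof (induction rule: generate_topology_on.induct)
    case Empty
    then show ?case by simp
  next
    case (Int a b)
    then have "finite ({i \<in> I. ?u i \<notin> a} \<union> {i \<in> I. ?u i \<notin> b})" by auto
    then show ?case by (rule rev_finite_subset) auto
  next
    case (UN \<N>)
    then obtain k where "k \<in> \<N>" "(\<lambda>x. 0) \<in> k" by auto
    then have "finite {i \<in> I. ?u i \<notin> k}" using UN.IH by auto
    then show ?case by (rule rev_finite_subset) (use \<open>k \<in> \<N>\<close> in auto)
  next
    case (Basis N)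
    then obtain \<phi> V where N: "N = {f \<in> Cfun K. \<phi> f \<in> V}" "\<phi> \<in> Cdual K" "open V" by auto
    have "\<phi> (\<lambda>x. 0) = 0" using Cdual_scale[OF N(2) Cfun_zero, of 0] by simp
    then have "0 \<in> V" using Basis.prems N(1) by auto
    then obtain \<epsilon> where \<epsilon>: "0 < \<epsilon>" "\<And>y. \<bar>y\<bar> < \<epsilon> \<Longrightarrow> y \<in> V"
      using N(3) by (auto simp: open_real)
    have "{i \<in> I. ?u i \<notin> N} \<subseteq> {i \<in> I. \<epsilon> \<le> \<bar>\<phi> (?u i)\<bar>}"
      using u \<epsilon>(2) N(1) by (fastforce simp: not_less[symmetric])
    then show ?case using \<phi>_fin[OF N(2) \<epsilon>(1)] finite_subset by blast
  qed
  show ?thesis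
    unfolding compactin_def
  proof (intro conjI allI impI)
    \<comment> \<open>The zero functional makes all of \<open>Cfun K\<close> a generating set, so
      the weak topology lives on the whole of \<open>Cfun K\<close>.\<close>
    have "(\<lambda>f. 0) \<in> Cdual K" by (auto simp: Cdual_def intro!: exI[of _ 0])
    then have "{f \<in> Cfun K. (\<lambda>f. 0::real) f \<in> UNIV} \<in> ?B" by blast
    then have "Cfun K \<subseteq> \<Union>?B" by auto
    moreover have "insert (\<lambda>x. 0) (?u ` I) \<subseteq> Cfun K" using u Cfun_zero by auto
    ultimately show "insert (\<lambda>x. 0) (?u ` I) \<subseteq> topspace (weak_topology_C K)"
      unfolding weak_topology_C_def topology_generated_by_topspace by (rule order_trans[rotated])
    fix \<U> assume \<U>: "(\<forall>N\<in>\<U>. openin (weak_topology_C K) N) \<and> insert (\<lambda>x. 0) (?u ` I) \<subseteq> \<Union>\<U>"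
    then obtain N where N: "N \<in> \<U>" "(\<lambda>x. 0) \<in> N" by auto
    then have "generate_topology_on ?B N"
      using \<U> by (simp add: weak_topology_C_def openin_topology_generated_by_iff)
    then have J: "finite {i \<in> I. ?u i \<notin> N}" using cofinite N(2) by blast
    have "\<forall>i\<in>I. \<exists>N'\<in>\<U>. ?u i \<in> N'" using \<U> by auto
    then obtain n where n: "\<And>i. i \<in> I \<Longrightarrow> n i \<in> \<U> \<and> ?u i \<in> n i" by metis
    show "\<exists>\<F>. finite \<F> \<and> \<F> \<subseteq> \<U> \<and> insert (\<lambda>x. 0) (?u ` I) \<subseteq> \<Union>\<F>"
      using J N n by (intro exI[of _ "insert N (n ` {i \<in> I. ?u i \<notin> N})"]) auto
  qed
qed

subsection \<open>Spaces of characteristic functions\<close>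

lemma topspace_family_space:
  "topspace (family_space Z \<B>) = (\<lambda>S. restrict (\<lambda>z. z \<in> S) Z) ` \<B>"
  by (auto simp: family_space_def cantor_cube_def)

lemma continuous_map_family_space_coordinate:
  assumes "z \<in> Z"
  shows "continuous_map (family_space Z \<B>) (discrete_topology UNIV) (\<lambda>x. x z)"
  unfolding family_space_def cantor_cube_def
  using assms by (intro continuous_map_from_subtopology continuous_map_product_projection)

text \<open>Cylinders serve twice: with \<open>a\<close> constantly \<open>True\<close> they are the
  sets of members containing \<open>F\<close>, and with \<open>a\<close> a point of the space they
  are its basic neighbourhoods.\<close>

lemma clopen_family_space_cylinder:
  assumes "finite F" "F \<subseteq> Z"
  shows "openin (family_space Z \<B>) {x \<in> topspace (family_space Z \<B>). \<forall>z\<in>F. x z = a z}"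
    and "closedin (family_space Z \<B>) {x \<in> topspace (family_space Z \<B>). \<forall>z\<in>F. x z = a z}"
proof -
  let ?K = "family_space Z \<B>"
  have "openin ?K {x \<in> topspace ?K. \<forall>z\<in>F. x z = a z} \<and>
        closedin ?K {x \<in> topspace ?K. \<forall>z\<in>F. x z = a z}"
    using assms
  proof (induction F rule: finite_induct)
    case (insert z F)
    have eq: "{x \<in> topspace ?K. \<forall>z\<in>insert z F. x z = a z} =
        {x \<in> topspace ?K. x z \<in> {a z}} \<inter> {x \<in> topspace ?K. \<forall>z\<in>F. x z = a z}"
      by auto
    have "continuous_map ?K (discrete_topology UNIV) (\<lambda>x. x z)"
      using insert.prems by (intro continuous_map_family_space_coordinate) auto
    then have "openin ?K {x \<in> topspace ?K. x z \<in> {a z}} \<and> closedin ?K {x \<in> topspace ?K. x z \<in> {a z}}"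
      by (intro conjI openin_continuous_map_preimage closedin_continuous_map_preimage) auto
    then show ?case using insert unfolding eq by auto
  qed auto
  then show "openin ?K {x \<in> topspace ?K. \<forall>z\<in>F. x z = a z}"
    and "closedin ?K {x \<in> topspace ?K. \<forall>z\<in>F. x z = a z}"
    by auto
qed

lemma Hausdorff_space_family_space: "Hausdorff_space (family_space Z \<B>)"
  unfolding family_space_def cantor_cube_def
  by (intro Hausdorff_space_subtopology)
     (simp add: Hausdorff_space_product_topology Hausdorff_space_discrete_topology)

text \<open>A family determined by its finite members is closed in the compact cube: a point outside
  it contains a finite set \<open>F\<close> not in the family, and the open cylinder
  \<open>D F\<close> then misses the family.\<close>

lemma compact_space_family_space:
  assumes sub: "\<And>S. S \<in> \<B> \<Longrightarrow> S \<subseteq> Z"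
    and finitary: "\<And>S. S \<subseteq> Z \<Longrightarrow> S \<in> \<B> \<longleftrightarrow> (\<forall>F. finite F \<and> F \<subseteq> S \<longrightarrow> F \<in> \<B>)"
  shows "compact_space (family_space Z \<B>)"
proof -
  let ?C = "cantor_cube Z" and ?T = "(\<lambda>S. restrict (\<lambda>z. z \<in> S) Z) ` \<B>"
  let ?\<F> = "{F. finite F \<and> F \<subseteq> Z \<and> F \<notin> \<B>}"
  define D where "D F = {x \<in> topspace ?C. \<forall>z\<in>F. x z = True}" for F
  \<comment> \<open>The cube is itself the space of a family, which makes the cylinder lemma
    available for it.\<close>
  have full: "family_space Z (Pow Z) = ?C"
  proof -
    have "x \<in> (\<lambda>S. restrict (\<lambda>z. z \<in> S) Z) ` Pow Z" if "x \<in> topspace ?C" for x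
    proof
      show "x = restrict (\<lambda>z. z \<in> {z \<in> Z. x z}) Z"
        using that by (auto simp: cantor_cube_def PiE_iff extensional_def restrict_def fun_eq_iff)
    qed auto
    then show ?thesis
      unfolding family_space_def by (intro subtopology_superset) auto
  qed
  have D: "openin ?C (D F)" if "finite F" "F \<subseteq> Z" for F
    using clopen_family_space_cylinder(1)[OF that, of "Pow Z" "\<lambda>_. True"]
    unfolding full D_def .
  have "?T = topspace ?C - (\<Union>F\<in>?\<F>. D F)"
  proof (intro set_eqI iffI)
    fix x assume "x \<in> ?T"
    then obtain S where S: "S \<in> \<B>" "x = restrict (\<lambda>z. z \<in> S) Z" by auto
    have "F \<in> \<B>" if F: "finite F" "F \<subseteq> Z" "x \<in> D F" for F
    proof -
      have "F \<subseteq> S" using F S(2) by (auto simp: D_def subset_iff)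
      then show ?thesis using finitary[OF sub[OF S(1)]] S(1) F(1) by auto
    qed
    moreover have "x \<in> topspace ?C" using S(2) by (simp add: cantor_cube_def)
    ultimately show "x \<in> topspace ?C - (\<Union>F\<in>?\<F>. D F)" by auto
  next
    fix x assume x: "x \<in> topspace ?C - (\<Union>F\<in>?\<F>. D F)"
    let ?S = "{z \<in> Z. x z}"
    have "F \<in> \<B>" if "finite F" "F \<subseteq> ?S" for F
    proof -
      have "x \<in> D F" using that x by (auto simp: D_def)
      then show ?thesis using that x by auto
    qed
    then have "?S \<in> \<B>" using finitary[of ?S] by auto
    moreover have "x = restrict (\<lambda>z. z \<in> ?S) Z"
      using x by (auto simp: cantor_cube_def PiE_iff extensional_def restrict_def fun_eq_iff)
    ultimately show "x \<in> ?T" by (rule rev_image_eqI)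
  qed
  moreover have "openin ?C (\<Union>F\<in>?\<F>. D F)"
    by (intro openin_Union) (auto intro: D)
  then have "closedin ?C (topspace ?C - (\<Union>F\<in>?\<F>. D F))"
    by (intro closedin_diff closedin_topspace)
  ultimately have "closedin ?C ?T" by (simp only:)
  have "compact_space ?C"
    by (simp add: cantor_cube_def compact_space_product_topology compact_space_discrete_topology)
  then have "compactin ?C ?T" using \<open>closedin ?C ?T\<close> by (rule closedin_compact_space)
  then show ?thesis unfolding family_space_def by (rule compact_space_subtopology)
qed

section \<open>Approximate dependence on finitely many coordinates\<close>

text \<open>A basic open box around \<open>x\<close> inside the preimage of a ball restricts only
  finitely many coordinates.\<close>

lemma family_space_continuous_finite_support:
  assumes f: "continuous_map (family_space Z \<B>) euclideanreal f"
    and x: "x \<in> topspace (family_space Z \<B>)" and "0 < \<epsilon>"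
  obtains F where "finite F" "F \<subseteq> Z"
    "\<And>y. y \<in> topspace (family_space Z \<B>) \<Longrightarrow> \<forall>z\<in>F. y z = x z \<Longrightarrow> \<bar>f y - f x\<bar> < \<epsilon>"
proof -
  let ?K = "family_space Z \<B>"
  have "openin ?K {y \<in> topspace ?K. f y \<in> ball (f x) \<epsilon>}"
    using f by (rule openin_continuous_map_preimage) auto
  then obtain S where S: "openin (cantor_cube Z) S"
      "{y \<in> topspace ?K. f y \<in> ball (f x) \<epsilon>} = S \<inter> topspace ?K"
    unfolding family_space_def openin_subtopology by auto
  have "x \<in> S" using S(2) x \<open>0 < \<epsilon>\<close> by force
  then obtain U where U: "finite {z \<in> Z. U z \<noteq> UNIV}" "x \<in> Pi\<^sub>E Z U" "Pi\<^sub>E Z U \<subseteq> S"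
    using S(1) by (force simp: cantor_cube_def openin_product_topology_alt)
  show ?thesis
  proof
    show "finite {z \<in> Z. U z \<noteq> UNIV}" by fact
    show "{z \<in> Z. U z \<noteq> UNIV} \<subseteq> Z" by auto
    fix y assume y: "y \<in> topspace ?K" "\<forall>z\<in>{z \<in> Z. U z \<noteq> UNIV}. y z = x z"
    have "y \<in> topspace (cantor_cube Z)" using y(1) by (simp add: family_space_def)
    have "y z \<in> U z" if "z \<in> Z" for z
    proof (cases "U z = UNIV")
      case False
      then have "y z = x z" using y(2) that by simp
      then show ?thesis using U(2) that by (auto simp: PiE_iff)
    qed simp
    moreover have "y \<in> extensional Z"
      using \<open>y \<in> topspace (cantor_cube Z)\<close> by (simp add: cantor_cube_def PiE_iff)
    ultimately have "y \<in> Pi\<^sub>E Z U" by (auto simp: PiE_iff)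
    then have "y \<in> S" using U(3) by blast
    then have "f y \<in> ball (f x) \<epsilon>" using S(2) y(1) by blast
    then show "\<bar>f y - f x\<bar> < \<epsilon>" by (simp add: dist_real_def abs_minus_commute)
  qed
qed

text \<open>Finitely many of the local cylinders cover the space, and the union of their coordinate
  sets works everywhere: points agreeing on it lie in a common cylinder.\<close>

lemma family_space_uniform_finite_support:
  assumes K: "compact_space (family_space Z \<B>)"
    and f: "continuous_map (family_space Z \<B>) euclideanreal f" and "0 < \<epsilon>"
  obtains F where "finite F" "F \<subseteq> Z"
    "\<And>x y. x \<in> topspace (family_space Z \<B>) \<Longrightarrow> y \<in> topspace (family_space Z \<B>) \<Longrightarrow>
       \<forall>z\<in>F. x z = y z \<Longrightarrow> \<bar>f x - f y\<bar> < \<epsilon>"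
proof -
  let ?K = "family_space Z \<B>"
  define N where "N F x = {y \<in> topspace ?K. \<forall>z\<in>F. y z = x z}" for F and x :: "'a \<Rightarrow> bool"
  have "\<forall>x\<in>topspace ?K. \<exists>F. finite F \<and> F \<subseteq> Z \<and> (\<forall>y\<in>N F x. \<bar>f y - f x\<bar> < \<epsilon> / 2)"
  proof
    fix x assume x: "x \<in> topspace ?K"
    have "0 < \<epsilon> / 2" using \<open>0 < \<epsilon>\<close> by simp
    obtain F where F: "finite F" "F \<subseteq> Z"
        "\<And>y. y \<in> topspace ?K \<Longrightarrow> \<forall>z\<in>F. y z = x z \<Longrightarrow> \<bar>f y - f x\<bar> < \<epsilon> / 2"
      by (rule family_space_continuous_finite_support[OF f x \<open>0 < \<epsilon> / 2\<close>]) (rule that)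
    have "\<bar>f y - f x\<bar> < \<epsilon> / 2" if "y \<in> N F x" for y
      using that unfolding N_def by (intro F(3)) blast+
    then show "\<exists>F. finite F \<and> F \<subseteq> Z \<and> (\<forall>y\<in>N F x. \<bar>f y - f x\<bar> < \<epsilon> / 2)"
      using F(1,2) by blast
  qed
  from bchoice[OF this] obtain F
    where "\<forall>x\<in>topspace ?K. finite (F x) \<and> F x \<subseteq> Z \<and> (\<forall>y\<in>N (F x) x. \<bar>f y - f x\<bar> < \<epsilon> / 2)" ..
  then have F: "\<And>x. x \<in> topspace ?K \<Longrightarrow> finite (F x)"
      "\<And>x. x \<in> topspace ?K \<Longrightarrow> F x \<subseteq> Z"
    "\<And>x y. x \<in> topspace ?K \<Longrightarrow> y \<in> N (F x) x \<Longrightarrow> \<bar>f y - f x\<bar> < \<epsilon> / 2"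
    by blast+
  have N: "openin ?K (N (F x) x)" "x \<in> N (F x) x" if "x \<in> topspace ?K" for x
    using that by (auto simp: N_def intro!: clopen_family_space_cylinder(1) F(1,2))
  obtain X where X: "finite X" "X \<subseteq> topspace ?K" "topspace ?K \<subseteq> (\<Union>x\<in>X. N (F x) x)"
  proof -
    obtain \<F> where \<F>: "finite \<F>" "\<F> \<subseteq> (\<lambda>x. N (F x) x) ` topspace ?K" "topspace ?K \<subseteq> \<Union>\<F>"
    proof -
      have "\<forall>V\<in>(\<lambda>x. N (F x) x) ` topspace ?K. openin ?K V" using N(1) by blast
      moreover have "topspace ?K \<subseteq> \<Union>((\<lambda>x. N (F x) x) ` topspace ?K)" using N(2) by blast
      ultimately show ?thesis
        using K that unfolding compact_space_def compactin_def by meson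
    qed
    obtain X where "X \<subseteq> topspace ?K" "finite X" "\<F> = (\<lambda>x. N (F x) x) ` X"
      using finite_subset_image[OF \<F>(1,2)] by blast
    then show ?thesis using that \<F>(3) by blast
  qed
  show ?thesis
  proof
    show "finite (\<Union>x\<in>X. F x)" "(\<Union>x\<in>X. F x) \<subseteq> Z" using X F(1,2) by blast+
    fix x y assume xy: "x \<in> topspace ?K" "y \<in> topspace ?K" "\<forall>z\<in>(\<Union>x\<in>X. F x). x z = y z"
    obtain u where u: "u \<in> X" "x \<in> N (F u) u" using X(3) xy(1) by blast
    have uK: "u \<in> topspace ?K" using u X(2) by blast
    have "y \<in> N (F u) u" using xy u by (auto simp: N_def)
    then have "\<bar>f y - f u\<bar> < \<epsilon> / 2" "\<bar>f x - f u\<bar> < \<epsilon> / 2" using F(3)[OF uK] u(2) by blast+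
    then show "\<bar>f x - f y\<bar> < \<epsilon>" by linarith
  qed
qed

text \<open>Splitting off \<open>z\<close>: \<open>h (S \<inter> insert z F) = h (S \<inter> F) + [z \<in> S] (h (insert z (S \<inter> F)) - h (S \<inter> F))\<close>.\<close>

lemma finite_set_function_expansion:
  fixes h :: "'a set \<Rightarrow> real"
  assumes "finite F"
  shows "\<exists>a. \<forall>S. h (S \<inter> F) = (\<Sum>G\<in>Pow F. a G * (if G \<subseteq> S then 1 else 0))"
  using assms
proof (induction F arbitrary: h rule: finite_induct)
  case empty
  show ?case by (rule exI[of _ h]) simp
next
  case (insert z F)
  obtain a where a: "\<And>S. h (S \<inter> F) = (\<Sum>G\<in>Pow F. a G * (if G \<subseteq> S then 1 else 0))"
    using insert.IH[of h] by auto
  obtain b where b: "\<And>S. h (insert z (S \<inter> F)) - h (S \<inter> F) =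
      (\<Sum>G\<in>Pow F. b G * (if G \<subseteq> S then 1 else 0))"
    using insert.IH[of "\<lambda>G. h (insert z G) - h G"] by auto
  \<comment> \<open>Subsets avoiding \<open>z\<close> carry the expansion of \<open>h\<close>; those
    containing \<open>z\<close> carry the expansion of the increment caused by adding
    \<open>z\<close>.\<close>
  define c where "c G = (if z \<in> G then b (G - {z}) else a G)" for G
  have "h (S \<inter> insert z F) = (\<Sum>G\<in>Pow (insert z F). c G * (if G \<subseteq> S then 1 else 0))" for S
  proof -
    have inj: "inj_on (insert z) (Pow F)"
      using insert.hyps(2) by (intro inj_onI) (metis Diff_insert_absorb PowD subsetD)
    have "(\<Sum>G\<in>Pow (insert z F). c G * (if G \<subseteq> S then 1 else 0)) =
        (\<Sum>G\<in>Pow F. c G * (if G \<subseteq> S then 1 else 0)) +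
        (\<Sum>G\<in>insert z ` Pow F. c G * (if G \<subseteq> S then 1 else (0::real)))"
      unfolding Pow_insert using insert.hyps by (intro sum.union_disjoint) auto
    also have "(\<Sum>G\<in>Pow F. c G * (if G \<subseteq> S then 1 else 0)) = h (S \<inter> F)"
      unfolding a by (rule sum.cong) (use insert.hyps in \<open>auto simp: c_def\<close>)
    also have "(\<Sum>G\<in>insert z ` Pow F. c G * (if G \<subseteq> S then 1 else 0)) =
        (\<Sum>G\<in>Pow F. c (insert z G) * (if insert z G \<subseteq> S then 1 else 0))"
      by (subst sum.reindex[OF inj]) simp
    also have "\<dots> = (\<Sum>G\<in>Pow F. b G * (if G \<subseteq> S then 1 else 0)) * (if z \<in> S then 1 else 0)"
      unfolding sum_distrib_right
    proof (rule sum.cong)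
      fix G assume "G \<in> Pow F"
      then have "insert z G - {z} = G" using insert.hyps by auto
      then show "c (insert z G) * (if insert z G \<subseteq> S then 1 else 0) =
          b G * (if G \<subseteq> S then 1 else 0) * (if z \<in> S then 1 else 0)"
        by (simp add: c_def)
    qed simp
    also have "\<dots> = (if z \<in> S then h (insert z (S \<inter> F)) - h (S \<inter> F) else 0)"
      unfolding b[symmetric] by simp
    finally show ?thesis by (simp add: Int_insert_right)
  qed
  then show ?case by (intro exI[of _ c] allI)
qed

text \<open>\<open>lin_span_C\<close> sums over sets of functions, so the coefficients of indices
  giving the same function have to be merged.\<close>

lemma sum_in_lin_span_C:
  assumes "finite I" "\<And>i. i \<in> I \<Longrightarrow> u i \<in> W"
  shows "(\<lambda>x. \<Sum>i\<in>I. a i * u i x) \<in> lin_span_C W"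
proof -
  have "(\<lambda>x. \<Sum>i\<in>I. a i * u i x) = (\<lambda>x. \<Sum>w\<in>u ` I. (\<Sum>i\<in>{i \<in> I. u i = w}. a i) * w x)"
    unfolding sum.image_gen[OF assms(1), of _ u] sum_distrib_right
    by (intro ext sum.cong) auto
  then show ?thesis
    unfolding lin_span_C_def using assms by (intro CollectI exI[of _ "u ` I"]) auto
qed

text \<open>The generating set consists of 0 and the weighted indicators of the sets of members
  containing a finite \<open>F\<close>. Weights at least \<open>\<epsilon>\<close> bound the levels
  of the points of \<open>F\<close>, so a given member contains only finitely many such
  \<open>F\<close>.\<close>

lemma WCG_C_family_space:
  fixes level :: "'a \<Rightarrow> nat"
  assumes K: "compact_space (family_space Z \<B>)"
    and fin: "\<And>S n. S \<in> \<B> \<Longrightarrow> finite {z \<in> S. level z \<le> n}"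
  shows "WCG_C (family_space Z \<B>)"
proof -
  let ?K = "family_space Z \<B>"
  define I where "I = {F. finite F \<and> F \<subseteq> Z}"
  define U where "U F = {x \<in> topspace ?K. \<forall>z\<in>F. x z = True}" for F
  define w where "w F = 1 / (1 + real (sum level F))" for F
  define u where "u F = (\<lambda>x. w F * indicator (U F) x)" for F
  define W where "W = insert (\<lambda>x. 0) (u ` I)"
  have U: "openin ?K (U F)" "closedin ?K (U F)" if "F \<in> I" for F
    using that clopen_family_space_cylinder[of F Z \<B> "\<lambda>_. True"] by (auto simp: I_def U_def)
  have w_pos: "0 < w F" for F
    unfolding w_def by (simp add: add_pos_nonneg del: of_nat_sum)
  have "compactin (weak_topology_C ?K) W"
    unfolding W_def u_def
  proof (rule weakly_compact_weighted_indicators[OF K U])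
    show "w F \<le> 1" for F by (simp add: w_def del: of_nat_sum)
    fix x \<epsilon> assume x: "x \<in> topspace ?K" and "0 < (\<epsilon>::real)"
    obtain S where S: "S \<in> \<B>" "x = restrict (\<lambda>z. z \<in> S) Z"
      using x by (auto simp: topspace_family_space)
    have "F \<subseteq> {z \<in> S. level z \<le> nat \<lceil>1 / \<epsilon>\<rceil>}" if F: "F \<in> I" "x \<in> U F" "\<epsilon> \<le> w F" for F
    proof
      fix z assume z: "z \<in> F"
      have "z \<in> S" using F z S(2) by (auto simp: I_def U_def)
      have "level z \<le> sum level F" using F(1) z by (intro member_le_sum) (auto simp: I_def)
      moreover have "\<epsilon> * (1 + real (sum level F)) \<le> 1"
        using F(3) by (simp add: w_def pos_le_divide_eq add_pos_nonneg del: of_nat_sum)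
      then have "real (sum level F) \<le> 1 / \<epsilon>"
        using \<open>0 < \<epsilon>\<close> by (simp add: pos_le_divide_eq algebra_simps del: of_nat_sum)
      then have "sum level F \<le> nat \<lceil>1 / \<epsilon>\<rceil>" by linarith
      ultimately show "z \<in> {z \<in> S. level z \<le> nat \<lceil>1 / \<epsilon>\<rceil>}" using \<open>z \<in> S\<close> by simp
    qed
    then have "{F \<in> I. x \<in> U F \<and> \<epsilon> \<le> w F} \<subseteq> Pow {z \<in> S. level z \<le> nat \<lceil>1 / \<epsilon>\<rceil>}" by auto
    then show "finite {F \<in> I. x \<in> U F \<and> \<epsilon> \<le> w F}"
      by (rule finite_subset) (simp add: fin S(1))
  qed (use w_pos in auto)
  moreover have "W \<subseteq> Cfun ?K"
    unfolding W_def u_def using U by (auto intro!: Cfun_zero Cfun_scale Cfun_indicator)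
  moreover have "\<exists>g\<in>lin_span_C W. supnorm ?K (\<lambda>x. f x - g x) < \<epsilon>"
    if f: "f \<in> Cfun ?K" and \<epsilon>: "0 < \<epsilon>" for f \<epsilon>
  proof -
    obtain F where F: "finite F" "F \<subseteq> Z" "\<And>x y. x \<in> topspace ?K \<Longrightarrow> y \<in> topspace ?K \<Longrightarrow>
        \<forall>z\<in>F. x z = y z \<Longrightarrow> \<bar>f x - f y\<bar> < \<epsilon> / 2"
      by (rule family_space_uniform_finite_support[OF K CfunD(1)[OF f] half_gt_zero[OF \<epsilon>]])
        (rule that)
    \<comment> \<open>A chosen point with trace \<open>G\<close> on \<open>F\<close>. Its value for
      unrealized traces is arbitrary and harmless, since the estimate below uses only traces of
      actual points.\<close>
    define rep where "rep G = (SOME y. y \<in> topspace ?K \<and> {z. y z} \<inter> F = G)" for G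
    obtain a where a: "\<And>S. f (rep (S \<inter> F)) = (\<Sum>G\<in>Pow F. a G * (if G \<subseteq> S then 1 else 0))"
      using finite_set_function_expansion[OF F(1), of "\<lambda>G. f (rep G)"] by auto
    \<comment> \<open>Dividing by \<open>w G\<close> undoes the scaling in \<open>u G\<close>,
      leaving the expansion of \<open>f (rep G)\<close> in indicators.\<close>
    let ?g = "\<lambda>x. \<Sum>G\<in>Pow F. a G / w G * u G x"
    have "?g \<in> lin_span_C W"
    proof (rule sum_in_lin_span_C)
      fix G assume "G \<in> Pow F"
      then have "G \<in> I" using F(1,2) finite_subset by (auto simp: I_def)
      then show "u G \<in> W" by (simp add: W_def)
    qed (use F(1) in simp)
    moreover have "supnorm ?K (\<lambda>x. f x - ?g x) \<le> \<epsilon> / 2"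
    proof (rule supnorm_least)
      fix x assume x: "x \<in> topspace ?K"
      let ?y = "rep ({z. x z} \<inter> F)"
      have y: "?y \<in> topspace ?K \<and> {z. ?y z} \<inter> F = {z. x z} \<inter> F"
        unfolding rep_def by (rule someI[of _ x]) (use x in auto)
      have "?g x = (\<Sum>G\<in>Pow F. a G * (if G \<subseteq> {z. x z} then 1 else 0))"
      proof (rule sum.cong)
        fix G
        have "x \<in> U G \<longleftrightarrow> G \<subseteq> {z. x z}" using x by (auto simp: U_def)
        then show "a G / w G * u G x = a G * (if G \<subseteq> {z. x z} then 1 else 0)"
          using w_pos[of G] by (simp add: u_def)
      qed simp
      then have "?g x = f ?y" by (simp add: a)
      moreover have "\<bar>f x - f ?y\<bar> < \<epsilon> / 2"
        using y by (intro F(3) x) auto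
      ultimately show "\<bar>f x - ?g x\<bar> \<le> \<epsilon> / 2" by simp
    qed (use \<epsilon> in simp)
    ultimately show ?thesis using \<epsilon> by (intro bexI[of _ ?g]) auto
  qed
  ultimately show ?thesis
    unfolding WCG_C_def by (intro exI[of _ W]) auto
qed

subsection \<open>Weak compactness and pointwise approximation\<close>

text \<open>Point evaluations are bounded functionals, and evaluations outside the space vanish on
  \<open>Cfun K\<close>. Hence the weak topology is finer than the topology of pointwise
  convergence, which is the one \<open>compact\<close> refers to.\<close>

lemma compact_of_weakly_compact:
  assumes K: "compact_space K" and W: "compactin (weak_topology_C K) W" "W \<subseteq> Cfun K"
  shows "compact W"
proof -
  have gen: "openin (weak_topology_C K) {f \<in> Cfun K. \<phi> f \<in> U}" if "\<phi> \<in> Cdual K" "open U" for \<phi> U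
    unfolding weak_topology_C_def using that by (intro topology_generated_by_Basis) auto
  have top: "topspace (weak_topology_C K) = Cfun K"
  proof
    show "topspace (weak_topology_C K) \<subseteq> Cfun K"
      unfolding weak_topology_C_def topology_generated_by_topspace by blast
    have "(\<lambda>f. 0) \<in> Cdual K" by (auto simp: Cdual_def intro!: exI[of _ 0])
    from gen[OF this, of UNIV] show "Cfun K \<subseteq> topspace (weak_topology_C K)"
      using openin_subset by fastforce
  qed
  have "continuous_map (weak_topology_C K) euclideanreal (\<lambda>f. f x)" for x
  proof (cases "x \<in> topspace K")
    case True
    then have "(\<lambda>f. f x) \<in> Cdual K"
      using supnorm_upper[OF K] by (auto simp: Cdual_def intro!: exI[of _ 1])
    then show ?thesis
      using gen by (auto simp: continuous_map_def top)
  next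
    case False
    have "continuous_map (weak_topology_C K) euclideanreal (\<lambda>f. 0)" by simp
    then show ?thesis
      by (rule continuous_map_eq) (use False in \<open>simp add: top CfunD(2)\<close>)
  qed
  then have "continuous_map (weak_topology_C K) euclidean (\<lambda>f. f)"
    unfolding euclidean_product_topology[symmetric] continuous_map_componentwise_UNIV by simp
  from image_compactin[OF W(1) this] show ?thesis by simp
qed

section \<open>Exhaustion of the span by pointwise compact sets\<close>

text \<open>The recursion exhibits each stage as a continuous image of a product, so compactness
  passes from \<open>W\<close> to every stage.\<close>

primrec bounded_combinations :: "real \<Rightarrow> ('b \<Rightarrow> real) set \<Rightarrow> nat \<Rightarrow> ('b \<Rightarrow> real) set" where
  "bounded_combinations N W 0 = {\<lambda>x. 0}"
| "bounded_combinations N W (Suc k) =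
     (\<lambda>(g, c, w) x. g x + c * w x) ` (bounded_combinations N W k \<times> {-N..N} \<times> W)"

lemma compact_bounded_combinations:
  assumes "compact W"
  shows "compact (bounded_combinations N W k)"
proof (induction k)
  case (Suc k)
  have coord: "continuous_on UNIV (\<lambda>g :: 'b \<Rightarrow> real. g x)" for x
    by (rule continuous_on_product_coordinates)
  have "continuous_on (bounded_combinations N W k \<times> {-N..N} \<times> W)
          (\<lambda>p. fst p x + fst (snd p) * snd (snd p) x)" for x
    by (intro continuous_intros continuous_on_compose2[OF coord]) auto
  then have "continuous_on (bounded_combinations N W k \<times> {-N..N} \<times> W)
          (\<lambda>(g, c, w) x. g x + c * w x)"
    unfolding case_prod_beta by (rule continuous_on_coordinatewise_then_product)
  then show ?case
    unfolding bounded_combinations.simps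
    by (rule compact_continuous_image) (intro compact_Times Suc.IH assms compact_Icc)
qed simp

lemma bounded_combinations_subset_Cfun:
  assumes "W \<subseteq> Cfun K"
  shows "bounded_combinations N W k \<subseteq> Cfun K"
proof (induction k)
  case (Suc k)
  have "(\<lambda>x. g x + c * w x) \<in> Cfun K" if "g \<in> bounded_combinations N W k" "w \<in> W" for g c w
    using Cfun_lincomb[of g K w 1 c] that Suc assms by auto
  then show ?case by auto
qed (simp add: Cfun_zero)

lemma sum_in_bounded_combinations:
  assumes "finite F" "F \<subseteq> W" "\<And>w. w \<in> F \<Longrightarrow> \<bar>c w\<bar> \<le> N"
  shows "(\<lambda>x. \<Sum>w\<in>F. c w * w x) \<in> bounded_combinations N W (card F)"
  using assms
proof (induction F rule: finite_induct)
  case (insert w F)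
  have "(\<lambda>x. \<Sum>v\<in>insert w F. c v * v x) = (\<lambda>x. (\<Sum>v\<in>F. c v * v x) + c w * w x)"
    using insert.hyps by (simp add: add.commute)
  moreover have "(\<lambda>x. \<Sum>v\<in>F. c v * v x) \<in> bounded_combinations N W (card F)"
    using insert by auto
  moreover have "c w \<in> {-N..N}" "w \<in> W" using insert.prems by (force simp: abs_le_iff)+
  ultimately show ?case
    using insert.hyps by (auto intro!: image_eqI[of _ _ "(\<lambda>x. \<Sum>v\<in>F. c v * v x, c w, w)"])
qed simp

lemma lin_span_C_subset_bounded_combinations:
  assumes "g \<in> lin_span_C W"
  obtains N k :: nat where "g \<in> bounded_combinations (real N) W k"
proof -
  obtain F c where F: "finite F" "F \<subseteq> W" "g = (\<lambda>x. \<Sum>w\<in>F. c w * w x)"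
    using assms by (auto simp: lin_span_C_def)
  \<comment> \<open>The sum of the absolute values dominates each coefficient separately.\<close>
  obtain N :: nat where N: "(\<Sum>w\<in>F. \<bar>c w\<bar>) \<le> real N"
    using real_arch_simple by blast
  have "\<bar>c w\<bar> \<le> real N" if "w \<in> F" for w
    using member_le_sum[of w F "\<lambda>w. \<bar>c w\<bar>"] F(1) N that by force
  then show ?thesis
    using that sum_in_bounded_combinations[OF F(1,2)] F(3) by blast
qed

text \<open>If every coordinate \<open>z \<in> A\<close> were approximable, a function in \<open>S\<close> would be an approximate
  limit of infinitely many coordinates: small at the empty set but large at every cofinite
  subset of \<open>A\<close>. These subsets converge to the empty set, so the function is discontinuous.\<close>

lemma finite_of_compact_coordinate_approximation:
  fixes \<B> :: "'a set set"
  assumes "compact S" and cont: "\<And>g. g \<in> S \<Longrightarrow> continuous_map (family_space Z \<B>) euclideanreal g"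
    and A: "A \<subseteq> Z" "\<And>B. B \<subseteq> A \<Longrightarrow> B \<in> \<B>"
    and approx: "\<And>z. z \<in> A \<Longrightarrow> \<exists>g\<in>S. \<forall>x\<in>topspace (family_space Z \<B>). \<bar>of_bool (x z) - g x\<bar> \<le> 1/4"
  shows "finite A"
proof (rule ccontr)
  assume inf: "infinite A"
  let ?K = "family_space Z \<B>"
  define p where "p B = restrict (\<lambda>z. z \<in> B) Z" for B
  have p: "p B \<in> topspace ?K" if "B \<subseteq> A" for B
    using A(2)[OF that] by (auto simp: topspace_family_space p_def)
  define D where "D G = {g. g (p {}) \<le> (1/4::real) \<and> 3/4 \<le> g (p (A - G))}" for G
  let ?\<G> = "{G. finite G \<and> G \<subseteq> A}"
  have "S \<inter> (\<Inter>G\<in>?\<G>. D G) \<noteq> {}"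
  proof (rule compact_imp_fip_image[OF \<open>compact S\<close>])
    show "closed (D G)" for G
      unfolding D_def
      by (intro closed_Collect_conj closed_Collect_le continuous_on_const continuous_on_product_coordinates)
    fix \<H> assume \<H>: "finite \<H>" "\<H> \<subseteq> ?\<G>"
    then have "finite (\<Union>\<H>)" by auto
    \<comment> \<open>One coordinate settles finitely many conditions: it is 0 at
      \<open>p {}\<close> and 1 at each \<open>p (A - G)\<close>, so an approximant within 1/4 lies
      in every \<open>D G\<close>.\<close>
    then obtain z where z: "z \<in> A" "z \<notin> \<Union>\<H>"
      using inf by (metis finite_subset subsetI)
    obtain g where g: "g \<in> S" "\<And>x. x \<in> topspace ?K \<Longrightarrow> \<bar>of_bool (x z) - g x\<bar> \<le> 1/4"
      using approx[OF z(1)] by auto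
    have "g \<in> D G" if "G \<in> \<H>" for G
    proof -
      have "\<not> p {} z" "p (A - G) z" using z A(1) that by (auto simp: p_def)
      then have "\<bar>0 - g (p {})\<bar> \<le> 1/4" "\<bar>1 - g (p (A - G))\<bar> \<le> 1/4"
        using g(2)[OF p[of "{}"]] g(2)[OF p[of "A - G"]] by simp_all
      then have "g (p {}) \<le> 1/4" "3/4 \<le> g (p (A - G))" by linarith+
      then show ?thesis by (simp add: D_def)
    qed
    then show "S \<inter> (\<Inter>G\<in>\<H>. D G) \<noteq> {}" using g(1) by blast
  qed
  then obtain g where g: "g \<in> S" "\<And>G. finite G \<Longrightarrow> G \<subseteq> A \<Longrightarrow> g \<in> D G" by auto
  obtain F where F: "finite F" "F \<subseteq> Z"
      "\<And>y. y \<in> topspace ?K \<Longrightarrow> \<forall>z\<in>F. y z = p {} z \<Longrightarrow> \<bar>g y - g (p {})\<bar> < 1/2"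
    by (rule family_space_continuous_finite_support[OF cont[OF g(1)] p[of "{}"], of "1/2"])
      (simp, simp, rule that)
  \<comment> \<open>The point \<open>p (A - A \<inter> F)\<close> agrees with \<open>p {}\<close> on
    \<open>F\<close>, so \<open>g\<close> changes by less than 1/2, whereas \<open>D\<close> demands
    a jump of at least 1/2.\<close>
  have "g \<in> D (A \<inter> F)" using F(1) by (intro g(2)) auto
  moreover have "\<bar>g (p (A - A \<inter> F)) - g (p {})\<bar> < 1/2"
    by (intro F(3) p ballI) (auto simp: p_def restrict_def)
  ultimately show False by (auto simp: D_def)
qed

text \<open>The indicator of each coordinate is within 1/4 of the span of \<open>W\<close>, hence of
  one of countably many compact sets \<open>T n\<close>. Sorting the coordinates by \<open>n\<close>
  gives the pieces.\<close>

lemma WCG_C_family_space_decomposition: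
  fixes \<B> :: "'a set set"
  assumes K: "compact_space (family_space Z \<B>)" and WCG: "WCG_C (family_space Z \<B>)"
    and hereditary: "\<And>A B. A \<in> \<B> \<Longrightarrow> B \<subseteq> A \<Longrightarrow> B \<in> \<B>"
  obtains Y :: "nat \<Rightarrow> 'a set"
  where "Z \<subseteq> (\<Union>n. Y n)" "\<And>n. Y n \<subseteq> Z" "\<And>n A. A \<in> \<B> \<Longrightarrow> A \<subseteq> Y n \<Longrightarrow> finite A"
proof -
  let ?K = "family_space Z \<B>"
  obtain W where W: "W \<subseteq> Cfun ?K" "compactin (weak_topology_C ?K) W"
      and dense: "\<And>f \<epsilon>. f \<in> Cfun ?K \<Longrightarrow> 0 < \<epsilon> \<Longrightarrow> \<exists>g\<in>lin_span_C W. supnorm ?K (\<lambda>x. f x - g x) < \<epsilon>"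
    using WCG unfolding WCG_C_def by blast
  \<comment> \<open>\<open>prod_decode\<close> enumerates all pairs of a coefficient bound and a
    number of terms.\<close>
  define T where "T n = bounded_combinations (real (fst (prod_decode n))) W (snd (prod_decode n))" for n
  have T: "compact (T n)" "T n \<subseteq> Cfun ?K" for n
    unfolding T_def
    by (intro compact_bounded_combinations compact_of_weakly_compact[OF K W(2,1)])
      (intro bounded_combinations_subset_Cfun W(1))
  define Y where "Y n = {z \<in> Z. \<exists>g\<in>T n. \<forall>x\<in>topspace ?K. \<bar>of_bool (x z) - g x\<bar> \<le> 1/4}" for n
  show ?thesis
  proof
    show "Z \<subseteq> (\<Union>n. Y n)"
    proof
      fix z assume z: "z \<in> Z"
      let ?U = "{x \<in> topspace ?K. \<forall>z\<in>{z}. x z = True}"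
      have "openin ?K ?U" "closedin ?K ?U"
        by (rule clopen_family_space_cylinder; use z in simp)+
      then have ind: "indicator ?U \<in> Cfun ?K" by (rule Cfun_indicator)
      then obtain g where g: "g \<in> lin_span_C W" "supnorm ?K (\<lambda>x. indicator ?U x - g x) < 1/4"
        using dense[of "indicator ?U" "1/4"] by auto
      obtain N k :: nat where Nk: "g \<in> bounded_combinations (real N) W k"
        using lin_span_C_subset_bounded_combinations[OF g(1)] .
      then have gT: "g \<in> T (prod_encode (N, k))" by (simp add: T_def)
      have "\<bar>of_bool (x z) - g x\<bar> \<le> 1/4" if x: "x \<in> topspace ?K" for x
      proof -
        have "(\<lambda>x. indicator ?U x - g x) \<in> Cfun ?K"
          using gT T(2) by (intro Cfun_diff ind) auto
        from supnorm_upper[OF K this x] g(2) have "\<bar>indicator ?U x - g x\<bar> \<le> 1/4" by simp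
        moreover have "indicator ?U x = (of_bool (x z) :: real)"
          using x by (simp add: indicator_def)
        ultimately show ?thesis by simp
      qed
      then have "z \<in> Y (prod_encode (N, k))" using z gT unfolding Y_def by blast
      then show "z \<in> (\<Union>n. Y n)" by blast
    qed
    show "Y n \<subseteq> Z" for n by (auto simp: Y_def)
    show "finite A" if "A \<in> \<B>" "A \<subseteq> Y n" for n A
    proof (rule finite_of_compact_coordinate_approximation[OF T(1)[of n], of Z \<B>])
      show "continuous_map ?K euclideanreal g" if "g \<in> T n" for g
        using that T(2) by (blast intro: CfunD(1))
      show "A \<subseteq> Z" using that(2) by (auto simp: Y_def)
      show "B \<in> \<B>" if "B \<subseteq> A" for B using hereditary \<open>A \<in> \<B>\<close> that .
      show "\<exists>g\<in>T n. \<forall>x\<in>topspace ?K. \<bar>of_bool (x z) - g x\<bar> \<le> 1/4" if "z \<in> A" for z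
        using that \<open>A \<subseteq> Y n\<close> unfolding Y_def by blast
    qed
  qed
qed

subsection \<open>Cofinal adequate families\<close>

lemma adequate_subset:
  assumes "adequate X \<A>" "A \<in> \<A>" "B \<subseteq> A"
  shows "B \<in> \<A>"
proof -
  have A: "A \<subseteq> topspace X" using assms(1,2) by (auto simp: adequate_def)
  then have B: "B \<subseteq> topspace X" using assms(3) by auto
  have "\<forall>F. finite F \<and> F \<subseteq> A \<longrightarrow> F \<in> \<A>" using assms(1,2) A unfolding adequate_def by blast
  then have "\<forall>F. finite F \<and> F \<subseteq> B \<longrightarrow> F \<in> \<A>" using assms(3) by blast
  then show ?thesis using assms(1) B unfolding adequate_def by blast
qed

lemma restrict_family_adequate:
  assumes "adequate X \<A>"
  shows "restrict_family \<A> Z = {A \<in> \<A>. A \<subseteq> Z}"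
  unfolding restrict_family_def
  using adequate_subset[OF assms] by (auto intro: inf.orderE)

lemma compact_space_restrict_family:
  assumes \<A>: "adequate X \<A>" and Z: "Z \<subseteq> topspace X"
  shows "compact_space (family_space Z (restrict_family \<A> Z))"
proof (rule compact_space_family_space)
  fix S assume S: "S \<subseteq> Z"
  then have "S \<subseteq> topspace X" using Z by auto
  then have "S \<in> \<A> \<longleftrightarrow> (\<forall>F. finite F \<and> F \<subseteq> S \<longrightarrow> F \<in> \<A>)"
    using \<A> unfolding adequate_def by blast
  then show "S \<in> restrict_family \<A> Z \<longleftrightarrow> (\<forall>F. finite F \<and> F \<subseteq> S \<longrightarrow> F \<in> restrict_family \<A> Z)"
    unfolding restrict_family_adequate[OF \<A>] using S by auto
qed (simp add: restrict_family_adequate[OF \<A>])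

text \<open>All subsets of \<open>A\<close> belong to the family and are therefore closed, so
  \<open>A \<inter> C\<close> is discrete as well as compact.\<close>

lemma cofinal_adequate_finite_Int_compactin:
  assumes \<A>: "cofinal_adequate X \<A>" and A: "A \<in> \<A>" and C: "compactin X C"
  shows "finite (A \<inter> C)"
proof -
  have closed: "closedin X B" if "B \<subseteq> A" for B
    using \<A> adequate_subset[OF _ A that] by (auto simp: cofinal_adequate_def)
  let ?B = "A \<inter> C"
  have "compactin X ?B"
    by (rule closed_compactin[OF C]) (auto intro: closed)
  moreover have "subtopology X ?B = discrete_topology ?B"
  proof -
    have "openin (subtopology X ?B) {x}" if "x \<in> ?B" for x
    proof -
      have "closedin (subtopology X ?B) (?B - {x})"
        using closed[of "?B - {x}"] by (intro closedin_subset_topspace) auto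
      moreover have "topspace (subtopology X ?B) = ?B"
        using closedin_subset[OF closed[of ?B]] by auto
      moreover have "?B - (?B - {x}) = {x}" using that by auto
      ultimately show ?thesis by (metis openin_diff openin_topspace)
    qed
    moreover have "topspace (subtopology X ?B) = ?B"
      using closedin_subset[OF closed[of ?B]] by auto
    ultimately show ?thesis by (metis discrete_topology_unique)
  qed
  ultimately show ?thesis
    by (simp add: compactin_subspace compact_space_discrete_topology)
qed

text \<open>An infinite subset of \<open>Y\<close> without accumulation points would be closed and
  discrete, and cofinality would give an infinite member inside \<open>Y\<close>. Compactness then
  follows from the Bolzano-Weierstrass criterion for closures in metric spaces.\<close>

lemma cofinal_adequate_compact_closure:
  assumes X: "metrizable_space X" and \<A>: "cofinal_adequate X \<A>" and Y: "Y \<subseteq> topspace X"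
    and fin: "\<And>A. A \<in> \<A> \<Longrightarrow> A \<subseteq> Y \<Longrightarrow> finite A"
  shows "compactin X (X closure_of Y)"
proof -
  obtain M d where "Metric_space M d" and Xd: "X = Metric_space.mtopology M d"
    using X by (auto simp: metrizable_space_def)
  interpret Metric_space M d by fact
  have "X derived_set_of T \<noteq> {}" if T: "infinite T" "T \<subseteq> Y" for T
  proof
    assume "X derived_set_of T = {}"
    then have "closed_discrete_in X T"
      using T(2) Y unfolding closed_discrete_in_def
      by (auto simp: closedin_contains_derived_set subtopology_eq_discrete_topology_eq)
    then obtain C where "C \<subseteq> T" "infinite C" "C \<in> \<A>"
      using \<A> T(1) unfolding cofinal_adequate_def by blast
    then show False using fin T(2) by blast
  qed
  then show ?thesis
    unfolding Xd compact_closure_of_eq_Bolzano_Weierstrass by blast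
qed

theorem theorem3p4:
  fixes X :: "'a topology" and P :: "'b topology" and e :: "'a \<Rightarrow> 'b"
    and \<A> :: "'a set set" and Z :: "'a set"
  assumes "metrizable_space X" and "separable_space X"
    and "Polish_space P" and "embedding_map X P e"
    and "coanalytic_in P (e ` topspace X)"
    and "cofinal_adequate X \<A>"
    and "Z \<subseteq> topspace X"
  shows "Eberlein_compact (family_space Z (restrict_family \<A> Z)) \<longleftrightarrow>
         (\<exists>C :: nat \<Rightarrow> 'a set. (\<forall>n. compactin X (C n) \<and> C n \<subseteq> topspace X) \<and> Z \<subseteq> (\<Union>n. C n))"
proof -
  have \<A>: "adequate X \<A>" using assms(6) by (simp add: cofinal_adequate_def)
  note K = compact_space_restrict_family[OF \<A> assms(7)]
  note restrict = restrict_family_adequate[OF \<A>, of Z]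
  show ?thesis
  proof
    assume "Eberlein_compact (family_space Z (restrict_family \<A> Z))"
    then have "WCG_C (family_space Z (restrict_family \<A> Z))"
      by (simp add: Eberlein_compact_def)
    moreover have "B \<in> restrict_family \<A> Z" if "A \<in> restrict_family \<A> Z" "B \<subseteq> A" for A B
      using that adequate_subset[OF \<A>] unfolding restrict by auto
    ultimately obtain Y :: "nat \<Rightarrow> 'a set" where Y: "Z \<subseteq> (\<Union>n. Y n)" "\<And>n. Y n \<subseteq> Z"
        "\<And>n A. A \<in> restrict_family \<A> Z \<Longrightarrow> A \<subseteq> Y n \<Longrightarrow> finite A"
      using WCG_C_family_space_decomposition[OF K] by metis
    have YX: "Y n \<subseteq> topspace X" for n using Y(2)[of n] assms(7) by auto
    have "compactin X (X closure_of Y n)" for n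
    proof (rule cofinal_adequate_compact_closure[OF assms(1,6) YX])
      \<comment> \<open>As \<open>Y n \<subseteq> Z\<close>, such an \<open>A\<close> belongs to the
        restricted family.\<close>
      show "finite A" if "A \<in> \<A>" "A \<subseteq> Y n" for A
        using that Y(2)[of n] Y(3)[of A n] unfolding restrict by auto
    qed
    moreover have "Z \<subseteq> (\<Union>n. X closure_of Y n)"
      using Y(1) closure_of_subset[OF YX] by blast
    ultimately show "\<exists>C :: nat \<Rightarrow> 'a set. (\<forall>n. compactin X (C n) \<and> C n \<subseteq> topspace X) \<and> Z \<subseteq> (\<Union>n. C n)"
      by (intro exI[of _ "\<lambda>n. X closure_of Y n"]) (simp add: closure_of_subset_topspace)
  next
    assume "\<exists>C :: nat \<Rightarrow> 'a set. (\<forall>n. compactin X (C n) \<and> C n \<subseteq> topspace X) \<and> Z \<subseteq> (\<Union>n. C n)"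
    then obtain C :: "nat \<Rightarrow> 'a set" where C: "\<And>n. compactin X (C n)" "Z \<subseteq> (\<Union>n. C n)"
      by auto
    \<comment> \<open>Points of level at most \<open>n\<close> lie in \<open>C 0\<close>, ...,
      \<open>C n\<close>, and each of these meets a member of the family in a finite set.\<close>
    define level where "level z = (LEAST n. z \<in> C n)" for z
    have level: "z \<in> C (level z)" if "z \<in> Z" for z
      unfolding level_def using C(2) that by (auto intro: LeastI)
    have "WCG_C (family_space Z (restrict_family \<A> Z))"
    proof (rule WCG_C_family_space[OF K])
      fix S and n :: nat assume S: "S \<in> restrict_family \<A> Z"
      have "{z \<in> S. level z \<le> n} \<subseteq> (\<Union>m\<le>n. S \<inter> C m)"
        using S level unfolding restrict by blast
      moreover have "finite (S \<inter> C m)" for m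
        using S cofinal_adequate_finite_Int_compactin[OF assms(6) _ C(1)] unfolding restrict by blast
      then have "finite (\<Union>m\<le>n. S \<inter> C m)" by (intro finite_UN_I) simp_all
      ultimately show "finite {z \<in> S. level z \<le> n}" by (rule finite_subset)
    qed
    then show "Eberlein_compact (family_space Z (restrict_family \<A> Z))"
      by (simp add: Eberlein_compact_def K Hausdorff_space_family_space)
  qed
qed

end
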